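(* Let $A\colon\mathbb{R}^+\to M(n,\mathbb{R})$ be continuous with $\sup_{t\in\mathbb{R}^+}\|A(t)\|=M>0$. Suppose that there are constants $K\ge 1$ and $\alpha>0$ such that the transition matrix $\Phi(t,s)$ of $\dot x=A(t)x$ satisfies $\|\Phi(t,s)\|\le Ke^{-\alpha(t-s)}$ for all $t\ge s\ge 0$. Let $f\colon\mathbb{R}^+\times\mathbb{R}^n\to\mathbb{R}^n$ be continuous and suppose that there are constants $\gamma,\mu\geq 0$ such that $|f(t,y)-f(t,\bar y)|\le\gamma|y-\bar y|$ and $|f(t,y)|\le\mu$ for all $t\ge 0$ and $y,\bar y\in\mathbb{R}^n$. Assume that $\frac{K\gamma}{\alpha}<1$. If the system $\dot y=A(t)y+f(t,y)$ has a unique equilibrium $\bar y\ne 0$, then $\bar y$ is globally uniformly asymptotically stable for this system.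
   Context: $\mathbb{R}^+=[0,+\infty)$; $M(n,\mathbb{R})$ is the space of real $n\times n$ matrices; $|\cdot|$ is a vector norm on $\mathbb{R}^n$ and $\|\cdot\|$ a matrix norm compatible with it ($|Bv|\le\|B\||v|$). The transition matrix $\Phi(t,s)$ is the solution of $\partial_t\Phi(t,s)=A(t)\Phi(t,s)$, $\Phi(s,s)=I$. A vector $\bar y\in\mathbb{R}^n$ is an equilibrium of $\dot y=A(t)y+f(t,y)$ if $A(t)\bar y+f(t,\bar y)=0$ for all $t\ge 0$. Write $t\mapsto y(t,t_0,\eta)$ for the solution with $y(t_0,t_0,\eta)=\eta$. The equilibrium $\bar y$ is globally uniformly asymptotically stable if it is uniformly stable (for every $\varepsilon>0$ there is $\delta>0$, independent of $t_0$, such that $|\eta-\bar y|<\delta$ implies $|y(t,t_0,\eta)-\bar y|<\varepsilon$ for all $t\ge t_0\ge 0$) and for every $\varepsilon>0$ and $c>0$ there is $T=T(\varepsilon,c)>0$ such that $|y(t,t_0,\eta)-\bar y|<\varepsilon$ for all $t_0\ge 0$, all $t>t_0+T$ and all $|\eta-\bar y|<c$. *)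

theory Defs
  imports "HOL-Analysis.Analysis"
begin

definition is_norm :: "('a::real_vector \<Rightarrow> real) \<Rightarrow> bool" where
  "is_norm N \<longleftrightarrow>
     (\<forall>x. N x = 0 \<longleftrightarrow> x = 0) \<and>
     (\<forall>c x. N (c *\<^sub>R x) = \<bar>c\<bar> * N x) \<and>
     (\<forall>x y. N (x + y) \<le> N x + N y)"

definition compatible_norms :: "(real^'n \<Rightarrow> real) \<Rightarrow> (real^'n^'n \<Rightarrow> real) \<Rightarrow> bool" where
  "compatible_norms N P \<longleftrightarrow> (\<forall>B v. N (B *v v) \<le> P B * N v)"

text \<open>The coefficients live on the half-line \<open>{0..}\<close>; values at negative times are irrelevant,
  so all derivatives are taken within a half-line (one-sided at its left end point).\<close>

definition transition_matrix ::
    "(real \<Rightarrow> real^'n^'n) \<Rightarrow> (real \<Rightarrow> real \<Rightarrow> real^'n^'n) \<Rightarrow> bool" where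
  "transition_matrix A \<Phi> \<longleftrightarrow>
     (\<forall>s\<ge>0. \<Phi> s s = mat 1 \<and>
        (\<forall>t\<ge>0. ((\<lambda>\<tau>. \<Phi> \<tau> s) has_vector_derivative (A t ** \<Phi> t s)) (at t within {0..})))"

definition equilibrium ::
    "(real \<Rightarrow> real^'n^'n) \<Rightarrow> (real \<Rightarrow> real^'n \<Rightarrow> real^'n) \<Rightarrow> real^'n \<Rightarrow> bool" where
  "equilibrium A f yb \<longleftrightarrow> (\<forall>t\<ge>0. A t *v yb + f t yb = 0)"

definition solves_ivp ::
    "(real \<Rightarrow> real^'n^'n) \<Rightarrow> (real \<Rightarrow> real^'n \<Rightarrow> real^'n) \<Rightarrow> real \<Rightarrow> real^'n \<Rightarrow> (real \<Rightarrow> real^'n) \<Rightarrow> bool"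
  where
  "solves_ivp A f t0 \<eta> u \<longleftrightarrow>
     u t0 = \<eta> \<and>
     (\<forall>t\<ge>t0. (u has_vector_derivative (A t *v u t + f t (u t))) (at t within {t0..}))"

text \<open>\<open>y t t0 \<eta>\<close> is \<^emph>\<open>the\<close> solution through \<open>(t0, \<eta>)\<close>: it exists on all of \<open>{t0..}\<close>
  and is the only one there.\<close>

definition solution_map ::
    "(real \<Rightarrow> real^'n^'n) \<Rightarrow> (real \<Rightarrow> real^'n \<Rightarrow> real^'n) \<Rightarrow> (real \<Rightarrow> real \<Rightarrow> real^'n \<Rightarrow> real^'n) \<Rightarrow> bool"
  where
  "solution_map A f y \<longleftrightarrow>
     (\<forall>t0\<ge>0. \<forall>\<eta>. solves_ivp A f t0 \<eta> (\<lambda>t. y t t0 \<eta>) \<and>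
        (\<forall>u. solves_ivp A f t0 \<eta> u \<longrightarrow> (\<forall>t\<ge>t0. u t = y t t0 \<eta>)))"

definition uniformly_stable ::
    "(real^'n \<Rightarrow> real) \<Rightarrow> (real \<Rightarrow> real \<Rightarrow> real^'n \<Rightarrow> real^'n) \<Rightarrow> real^'n \<Rightarrow> bool" where
  "uniformly_stable N y yb \<longleftrightarrow>
     (\<forall>\<epsilon>>0. \<exists>\<delta>>0. \<forall>t0\<ge>0. \<forall>\<eta>. N (\<eta> - yb) < \<delta> \<longrightarrow> (\<forall>t\<ge>t0. N (y t t0 \<eta> - yb) < \<epsilon>))"

definition globally_uniformly_attractive ::
    "(real^'n \<Rightarrow> real) \<Rightarrow> (real \<Rightarrow> real \<Rightarrow> real^'n \<Rightarrow> real^'n) \<Rightarrow> real^'n \<Rightarrow> bool" where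
  "globally_uniformly_attractive N y yb \<longleftrightarrow>
     (\<forall>\<epsilon>>0. \<forall>c>0. \<exists>T>0. \<forall>t0\<ge>0. \<forall>t>t0 + T. \<forall>\<eta>. N (\<eta> - yb) < c \<longrightarrow> N (y t t0 \<eta> - yb) < \<epsilon>)"

text \<open>The existential quantifier introduces the solution map of the system. It makes the
  well-posedness presupposed by the notation \<open>y(t, t0, \<eta>)\<close> explicit, so that stability
  cannot hold vacuously for lack of global solutions.\<close>

definition globally_uniformly_asymptotically_stable ::
    "(real^'n \<Rightarrow> real) \<Rightarrow> (real \<Rightarrow> real^'n^'n) \<Rightarrow> (real \<Rightarrow> real^'n \<Rightarrow> real^'n) \<Rightarrow> real^'n \<Rightarrow> bool" where
  "globally_uniformly_asymptotically_stable N A f yb \<longleftrightarrow>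
     (\<exists>y. solution_map A f y \<and> uniformly_stable N y yb \<and> globally_uniformly_attractive N y yb)"

end

theory Submission
  imports Defs
begin

text \<open>The difference \<open>d\<close> of two solutions solves the linear system with forcing
  \<open>f t (u t) - f t (v t)\<close>, whose size is at most \<open>\<gamma> N (d t)\<close>. By variation of constants and the
  exponential bound on \<open>\<Phi>\<close>, the function \<open>\<phi> t = exp (\<alpha> (t - s)) N (d t)\<close> satisfies
  \<open>\<phi> t \<le> K \<phi> s + K \<gamma> \<integral> \<phi>\<close>, and Gronwall's inequality turns this into
  \<open>N (d t) \<le> K exp (- (\<alpha> - K \<gamma>) (t - s)) N (d s)\<close> (lemma \<open>solutions_contract\<close>). The rate
  \<open>\<alpha> - K \<gamma>\<close> is positive exactly because \<open>K \<gamma> / \<alpha> < 1\<close>.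

  This one estimate serves three purposes. With equal initial values it gives uniqueness of
  solutions. With \<open>v\<close> the constant solution at the equilibrium it says that every solution decays
  to the equilibrium exponentially, with constants that do not depend on the initial time: the
  factor \<open>K\<close> alone gives uniform stability, and the rate gives uniform attraction from every ball.

  Two ingredients come from a global existence theorem for right-hand sides that are Lipschitz in
  the state (lemma \<open>lipschitz_ode_global_solution\<close>), a Banach fixed point argument in an exponentially
  weighted supremum norm. Applied to the system itself, it provides the solution map. Applied to
  the adjoint matrix equation \<open>Z' = - Z A\<close>, it provides a differentiable inverse of \<open>\<Phi> t 0\<close>, which is
  what variation of constants needs: \<open>\<Phi> t s\<close> is only known to be differentiable in \<open>t\<close>, but it
  factors as \<open>\<Phi> t 0 ** Z s\<close>.\<close>

section \<open>Norms on Euclidean spaces\<close>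

lemma is_norm_zero: "is_norm N \<Longrightarrow> N 0 = 0"
  by (simp add: is_norm_def)

lemma is_norm_minus: "is_norm N \<Longrightarrow> N (- x) = N x"
  unfolding is_norm_def by (metis abs_minus_cancel abs_one mult_1 scaleR_minus1_left)

lemma is_norm_scaleR: "is_norm N \<Longrightarrow> N (c *\<^sub>R x) = \<bar>c\<bar> * N x"
  by (simp add: is_norm_def)

lemma is_norm_triangle: "is_norm N \<Longrightarrow> N (x + y) \<le> N x + N y"
  by (simp add: is_norm_def)

lemma is_norm_nonneg:
  assumes "is_norm N"
  shows "0 \<le> N x"
  using is_norm_triangle[OF assms, of x "- x"] is_norm_minus[OF assms, of x] is_norm_zero[OF assms]
  by simp

lemma is_norm_minus_commute: "is_norm N \<Longrightarrow> N (x - y) = N (y - x)"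
  using is_norm_minus[of N "x - y"] by simp

lemma is_norm_triangle_diff:
  assumes "is_norm N"
  shows "\<bar>N x - N y\<bar> \<le> N (x - y)"
  using is_norm_triangle[OF assms, of y "x - y"] is_norm_triangle[OF assms, of x "y - x"]
    is_norm_minus_commute[OF assms, of x y]
  by simp

lemma is_norm_sum:
  assumes "is_norm N"
  shows "N (sum g S) \<le> (\<Sum>i\<in>S. N (g i))"
proof (induction S rule: infinite_finite_induct)
  case (insert i S)
  then show ?case
    using is_norm_triangle[OF assms, of "g i" "sum g S"] by simp
qed (simp_all add: is_norm_zero[OF assms])

text \<open>Expanding in the orthonormal basis reduces the upper bound to the finitely many values of \<open>N\<close>
  there; the summand 1 keeps the constant positive without a dimension argument.\<close>

lemma is_norm_bounded_by_norm:
  fixes N :: "'a::euclidean_space \<Rightarrow> real"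
  assumes "is_norm N"
  obtains C where "C > 0" "\<And>x. N x \<le> C * norm x"
proof
  show "1 + (\<Sum>b\<in>Basis. N b) > 0"
    by (smt (verit) is_norm_nonneg[OF assms] sum_nonneg)
  show "N x \<le> (1 + (\<Sum>b\<in>Basis. N b)) * norm x" for x
  proof -
    have "N x = N (\<Sum>b\<in>Basis. (x \<bullet> b) *\<^sub>R b)"
      by (simp add: euclidean_representation)
    also have "\<dots> \<le> (\<Sum>b\<in>Basis. N ((x \<bullet> b) *\<^sub>R b))"
      by (rule is_norm_sum[OF assms])
    also have "\<dots> \<le> (\<Sum>b\<in>Basis. N b * norm x)"
      by (intro sum_mono)
        (simp add: is_norm_scaleR[OF assms] Basis_le_norm is_norm_nonneg[OF assms]
          mult.commute[of _ "N _"] mult_left_mono)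
    also have "\<dots> \<le> (1 + (\<Sum>b\<in>Basis. N b)) * norm x"
      by (simp add: distrib_right sum_distrib_right)
    finally show ?thesis .
  qed
qed

lemma is_norm_continuous_on:
  fixes N :: "'a::euclidean_space \<Rightarrow> real"
  assumes "is_norm N"
  shows "continuous_on S N"
proof -
  obtain C where C: "C > 0" "\<And>x. N x \<le> C * norm x"
    using is_norm_bounded_by_norm[OF assms] by blast
  have "C-lipschitz_on S N"
    using C is_norm_triangle_diff[OF assms]
    by (intro lipschitz_onI) (auto simp: dist_norm intro: order_trans)
  then show ?thesis
    by (rule lipschitz_on_continuous_on)
qed

text \<open>The lower bound is compactness: the continuous function \<open>N\<close> has a positive minimum on the
  Euclidean unit sphere, and homogeneity carries this to all vectors.\<close>

lemma is_norm_bounds_norm: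
  fixes N :: "'a::euclidean_space \<Rightarrow> real"
  assumes "is_norm N"
  obtains C where "C > 0" "\<And>x. norm x \<le> C * N x"
proof -
  have "\<exists>b\<in>sphere 0 1. \<forall>x\<in>sphere (0::'a) 1. N b \<le> N x"
    by (rule continuous_attains_inf) (auto intro: is_norm_continuous_on[OF assms])
  then obtain b where b: "norm b = 1" "\<And>x. norm x = 1 \<Longrightarrow> N b \<le> N x"
    by auto
  have "b \<noteq> 0" using b(1) by auto
  then have pos: "N b > 0"
    using assms is_norm_nonneg[OF assms, of b] by (auto simp: is_norm_def less_le)
  have "norm x \<le> (1 / N b) * N x" for x
  proof (cases "x = 0")
    case False
    have "N b \<le> N (x /\<^sub>R norm x)"
      using False by (intro b(2)) simp
    then show ?thesis
      using False pos by (simp add: is_norm_scaleR[OF assms] field_simps)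
  qed (simp add: is_norm_zero[OF assms])
  then show ?thesis
    using that[of "1 / N b"] pos by simp
qed

text \<open>The norm of a vector-valued integral passes to the limit from Riemann sums, where it is the
  triangle inequality; this way it is available for an arbitrary norm \<open>N\<close>, not only for the
  Euclidean one.\<close>

lemma is_norm_has_integral_le:
  fixes N :: "'a::euclidean_space \<Rightarrow> real" and h :: "real \<Rightarrow> 'a"
  assumes N: "is_norm N"
    and h: "(h has_integral I) {a..b}" and k: "(k has_integral J) {a..b}"
    and le: "\<And>x. x \<in> {a..b} \<Longrightarrow> N (h x) \<le> k x"
  shows "N I \<le> J"
proof -
  let ?F = "division_filter (cbox a b)"
  have k': "((\<lambda>p. \<Sum>(x,S)\<in>p. measure lborel S *\<^sub>R k x) \<longlongrightarrow> J) ?F"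
    using k by (simp add: has_integral_cbox flip: box_real)
  have "((\<lambda>p. \<Sum>(x,S)\<in>p. measure lborel S *\<^sub>R h x) \<longlongrightarrow> I) ?F"
    using h by (simp add: has_integral_cbox flip: box_real)
  then have h': "((\<lambda>p. N (\<Sum>(x,S)\<in>p. measure lborel S *\<^sub>R h x)) \<longlongrightarrow> N I) ?F"
    by (rule continuous_on_tendsto_compose[OF is_norm_continuous_on[OF N, of UNIV]]) auto
  have "\<forall>\<^sub>F p in ?F. N (\<Sum>(x,S)\<in>p. measure lborel S *\<^sub>R h x) \<le> (\<Sum>(x,S)\<in>p. measure lborel S *\<^sub>R k x)"
    using eventually_division_filter_tagged_division
  proof eventually_elim
    case (elim p)
    have "N (\<Sum>(x,S)\<in>p. measure lborel S *\<^sub>R h x) \<le> (\<Sum>z\<in>p. N (case z of (x,S) \<Rightarrow> measure lborel S *\<^sub>R h x))"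
      by (rule is_norm_sum[OF N])
    also have "\<dots> \<le> (\<Sum>(x,S)\<in>p. measure lborel S *\<^sub>R k x)"
      using tag_in_interval[OF elim] le
      by (intro sum_mono) (auto simp: is_norm_scaleR[OF N] intro!: mult_left_mono)
    finally show ?case .
  qed
  then show ?thesis
    by (rule tendsto_le[OF division_filter_not_empty k' h'])
qed

section \<open>Global existence for Lipschitz right-hand sides\<close>

text \<open>The weight \<open>exp (- l (s - a))\<close> absorbs the growth of the integral; the bound \<open>C / l\<close>, which is
  uniform in \<open>s\<close>, is what makes the Picard operator a contraction on the whole half-line.\<close>

lemma weighted_integral_bound:
  fixes g :: "real \<Rightarrow> 'a::banach"
  assumes g: "continuous_on {a..s} g" and l: "l > 0" and s: "a \<le> s" and C: "C \<ge> 0"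
    and bd: "\<And>r. r \<in> {a..s} \<Longrightarrow> norm (g r) \<le> C * exp (l * (r - a))"
  shows "norm (exp (- l * (s - a)) *\<^sub>R integral {a..s} g) \<le> C / l"
proof -
  have k: "((\<lambda>r. C * exp (l * (r - a))) has_integral
      (C / l * exp (l * (s - a)) - C / l * exp (l * (a - a)))) {a..s}"
    using l s
    by (intro fundamental_theorem_of_calculus)
      (auto intro!: derivative_eq_intros simp flip: has_real_derivative_iff_has_vector_derivative)
  have "norm (integral {a..s} g) \<le> integral {a..s} (\<lambda>r. C * exp (l * (r - a)))"
    using g k bd
    by (intro integral_norm_bound_integral)
      (auto intro: integrable_continuous_real has_integral_integrable)
  also have "\<dots> = C / l * exp (l * (s - a)) - C / l"
    using integral_unique[OF k] by simp
  also have "\<dots> \<le> C / l * exp (l * (s - a))"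
    using C l by simp
  finally have "exp (- l * (s - a)) * norm (integral {a..s} g)
      \<le> exp (- l * (s - a)) * (C / l * exp (l * (s - a)))"
    by (intro mult_left_mono) auto
  also have "\<dots> = C / l"
    by (simp add: mult.left_commute flip: exp_add)
  finally show ?thesis by simp
qed

lemma solution_if_integral_equation:
  fixes F :: "real \<Rightarrow> 'a::banach \<Rightarrow> 'a"
  assumes G: "continuous_on {a..} (\<lambda>r. F r (u r))"
    and u: "\<And>t. t \<ge> a \<Longrightarrow> u t = \<eta> + integral {a..t} (\<lambda>r. F r (u r))"
    and t: "t \<ge> a"
  shows "(u has_vector_derivative F t (u t)) (at t within {a..})"
proof -
  have "((\<lambda>t. integral {a..t} (\<lambda>r. F r (u r))) has_vector_derivative F t (u t))
      (at t within {a..t + 1})"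
    using t by (intro integral_has_vector_derivative continuous_on_subset[OF G]) auto
  moreover have "at t within {a..t + 1} = at t within {a..}"
    by (rule at_within_nhd[where S = "{..<t + 1}"]) auto
  ultimately have "((\<lambda>t. \<eta> + integral {a..t} (\<lambda>r. F r (u r))) has_vector_derivative F t (u t))
      (at t within {a..})"
    by (auto intro!: derivative_eq_intros)
  then show ?thesis
    by (rule has_vector_derivative_transform[rotated 2]) (use u t in auto)
qed

text \<open>Picard's operator for \<open>u' = F t u\<close> acts here on \<open>w t = exp (- l (t - a)) u t\<close>. As soon as \<open>l > L\<close> it
  contracts the bounded continuous functions with factor \<open>L / l\<close>, so that its fixed point
  yields at once a solution on the entire half-line. The bound
  on \<open>F t 0\<close> makes the operator preserve boundedness.\<close>

theorem lipschitz_ode_global_solution: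
  fixes F :: "real \<Rightarrow> 'a::banach \<Rightarrow> 'a"
  assumes cont: "continuous_on ({a..} \<times> UNIV) (\<lambda>(t, x). F t x)"
    and L: "L \<ge> 0"
    and lip: "\<And>t x y. t \<ge> a \<Longrightarrow> norm (F t x - F t y) \<le> L * norm (x - y)"
    and bdd: "\<And>t. t \<ge> a \<Longrightarrow> norm (F t 0) \<le> B"
  obtains u where "u a = \<eta>"
    and "\<And>t. t \<ge> a \<Longrightarrow> (u has_vector_derivative F t (u t)) (at t within {a..})"
proof -
  \<comment> \<open>Any \<open>l > L\<close> gives \<open>L / l < 1\<close>; the value \<open>2 * L\<close> would vanish for \<open>L = 0\<close>.\<close>
  define l where "l = 2 * L + 1"
  have l: "l > 0" using L by (simp add: l_def)
  have B: "B \<ge> 0" using bdd[of a] norm_ge_zero[of "F a 0"] by linarith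
  define G where "G w r = F r (exp (l * (r - a)) *\<^sub>R w r)" for w :: "real \<Rightarrow>\<^sub>C 'a" and r
  define Q where "Q w s = exp (- l * (s - a)) *\<^sub>R (\<eta> + integral {a..s} (G w))"
    for w :: "real \<Rightarrow>\<^sub>C 'a" and s
  have Gcont: "continuous_on {a..} (G w)" for w
  proof -
    have "continuous_on {a..} ((\<lambda>(t, x). F t x) \<circ> (\<lambda>r. (r, exp (l * (r - a)) *\<^sub>R w r)))"
      by (intro continuous_on_compose continuous_on_subset[OF cont] continuous_intros) auto
    then show ?thesis
      unfolding G_def by (simp add: o_def)
  qed
  have Gcont': "continuous_on {a..s} (G w)" for w s
    by (rule continuous_on_subset[OF Gcont]) auto
  have Gbound: "norm (G w r) \<le> (B + L * norm w) * exp (l * (r - a))" if "r \<ge> a" for w r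
  proof -
    have e: "1 \<le> exp (l * (r - a))" using l that by simp
    have "norm (G w r) \<le> norm (F r 0) + norm (G w r - F r 0)"
      by (metis add.commute diff_add_cancel norm_triangle_ineq)
    also have "\<dots> \<le> B + L * norm (exp (l * (r - a)) *\<^sub>R w r)"
      unfolding G_def using bdd[OF that] lip[OF that, of _ 0] by (smt (verit) diff_zero)
    also have "\<dots> \<le> B * exp (l * (r - a)) + L * (exp (l * (r - a)) * norm w)"
      using B L e norm_bounded[of w r]
      by (intro add_mono) (auto intro!: mult_left_mono simp: mult_le_cancel_left1)
    finally show ?thesis by (simp add: algebra_simps)
  qed
  have Glip: "norm (G v r - G w r) \<le> (L * dist v w) * exp (l * (r - a))" if "r \<ge> a" for v w r
  proof -
    have "norm (G v r - G w r) \<le> L * norm (exp (l * (r - a)) *\<^sub>R (v r - w r))"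
      unfolding G_def scaleR_diff_right by (rule lip[OF that])
    also have "\<dots> \<le> L * (exp (l * (r - a)) * dist v w)"
      using L dist_bounded[of v r w] by (auto intro!: mult_left_mono simp: dist_norm)
    finally show ?thesis by (simp add: algebra_simps)
  qed
  have Qcont: "continuous_on {a..} (Q w)" for w
  proof -
    have "continuous_on {a..} (\<lambda>t. integral {a..t} (G w))"
      unfolding continuous_on_eq_continuous_within
    proof
      fix t assume "t \<in> {a..}"
      then have "((\<lambda>t. integral {a..t} (G w)) has_vector_derivative G w t) (at t within {a..t + 1})"
        by (intro integral_has_vector_derivative Gcont') auto
      moreover have "at t within {a..t + 1} = at t within {a..}"
        by (rule at_within_nhd[where S = "{..<t + 1}"]) auto
      ultimately show "continuous (at t within {a..}) (\<lambda>t. integral {a..t} (G w))"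
        by (metis has_vector_derivative_continuous)
    qed
    then show ?thesis
      unfolding Q_def by (intro continuous_intros)
  qed
  have Qbound: "norm (Q w s) \<le> norm \<eta> + (B + L * norm w) / l" if "s \<ge> a" for w s
  proof -
    have "norm (exp (- l * (s - a)) *\<^sub>R integral {a..s} (G w)) \<le> (B + L * norm w) / l"
      using that B L Gbound by (intro weighted_integral_bound Gcont' l) auto
    moreover have "norm (exp (- l * (s - a)) *\<^sub>R \<eta>) \<le> norm \<eta>"
      using l that by (auto intro!: mult_left_le_one_le)
    ultimately show ?thesis
      unfolding Q_def scaleR_add_right by (smt (verit) norm_triangle_ineq)
  qed
  have bc: "(\<lambda>t. Q w (max a t)) \<in> bcontfun" for w
  proof (rule bcontfun_normI)
    show "continuous_on UNIV (\<lambda>t. Q w (max a t))"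
      by (rule continuous_on_compose2[OF Qcont]) (auto intro!: continuous_intros)
    show "norm (Q w (max a t)) \<le> norm \<eta> + (B + L * norm w) / l" for t
      by (rule Qbound) simp
  qed
  \<comment> \<open>Bounded continuous functions live on all of \<open>\<real>\<close>, so the image is extended constantly to the left of \<open>a\<close>.\<close>
  define T where "T w = Bcontfun (\<lambda>t. Q w (max a t))" for w
  have T: "apply_bcontfun (T w) t = Q w (max a t)" for w t
    unfolding T_def using Bcontfun_inverse[OF bc] by simp
  have "\<exists>!w. T w = w"
  proof (rule banach_fix_type)
    show "0 \<le> L / l" "L / l < 1"
      using L by (auto simp: l_def)
    show "\<forall>v w. dist (T v) (T w) \<le> L / l * dist v w"
    proof (intro allI dist_bound)
      fix v w t
      define s where "s = max a t"
      have s: "a \<le> s" by (simp add: s_def)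
      have "Q v s - Q w s = exp (- l * (s - a)) *\<^sub>R integral {a..s} (\<lambda>r. G v r - G w r)"
        unfolding Q_def
        by (subst Henstock_Kurzweil_Integration.integral_diff)
          (auto intro!: integrable_continuous_real Gcont' simp: algebra_simps)
      also have "norm \<dots> \<le> L * dist v w / l"
        using s L Glip
        by (intro weighted_integral_bound continuous_intros Gcont' l) auto
      finally show "dist (T v t) (T w t) \<le> L / l * dist v w"
        by (simp add: T dist_norm s_def)
    qed
  qed
  then obtain w where "T w = w" by blast
  then have w: "w t = Q w t" if "t \<ge> a" for t
    using T[of w t] that by (simp add: max_def)
  define u where "u t = exp (l * (t - a)) *\<^sub>R w t" for t
  have FG: "(\<lambda>r. F r (u r)) = G w"
    by (auto simp: G_def u_def)
  have u: "u t = \<eta> + integral {a..t} (\<lambda>r. F r (u r))" if "t \<ge> a" for t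
    unfolding FG using w[OF that] by (simp add: u_def Q_def flip: exp_add)
  show ?thesis
  proof
    show "u a = \<eta>" using u[of a] by simp
    show "(u has_vector_derivative F t (u t)) (at t within {a..})" if "t \<ge> a" for t
      by (rule solution_if_integral_equation[where F = F and u = u, OF Gcont[of w, folded FG] u that])
  qed
qed

section \<open>Linear systems\<close>

lemma bounded_bilinear_matrix_vector_mult:
  "bounded_bilinear (\<lambda>(B :: real^'n^'m) v. B *v v)"
  unfolding bilinear_conv_bounded_bilinear[symmetric] bilinear_def
proof (intro conjI allI)
  show "linear (\<lambda>v. B *v v)" for B :: "real^'n^'m" by simp
  show "linear (\<lambda>B :: real^'n^'m. B *v v)" for v
    by (rule linearI) (simp_all add: matrix_vector_mult_add_rdistrib scaleR_matrix_vector_assoc)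
qed

lemma bounded_bilinear_matrix_matrix_mult:
  "bounded_bilinear (\<lambda>(B :: real^'n^'m) (C :: real^'k^'n). B ** C)"
  unfolding bilinear_conv_bounded_bilinear[symmetric] bilinear_def
proof (intro conjI allI)
  show "linear (\<lambda>C. B ** C)" for B :: "real^'n^'m"
    by (rule linearI) (simp_all add: matrix_add_ldistrib matrix_scalar_ac scalar_matrix_assoc)
  show "linear (\<lambda>B. B ** C)" for C :: "real^'k^'n"
    by (rule linearI) (simp_all add: matrix_matrix_mult_def vec_eq_iff sum.distrib distrib_right
        sum_distrib_left mult.assoc)
qed

text \<open>The matrix \<open>Z\<close> will turn out to be the inverse of the fundamental matrix \<open>\<Phi> t 0\<close>. Obtaining it
  as a solution of a differential equation makes its differentiability immediate.\<close>

lemma adjoint_solution_exists: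
  fixes A :: "real \<Rightarrow> real^'n^'n"
  assumes A: "continuous_on {0..} A" and C: "\<And>t. t \<ge> 0 \<Longrightarrow> norm (A t) \<le> C"
  obtains Z where "Z 0 = mat 1"
    and "\<And>t. t \<ge> 0 \<Longrightarrow> (Z has_vector_derivative - (Z t ** A t)) (at t within {0..})"
proof -
  interpret mm: bounded_bilinear "\<lambda>(B :: real^'n^'n) (C :: real^'n^'n). B ** C"
    by (rule bounded_bilinear_matrix_matrix_mult)
  obtain D where D: "D > 0" "\<And>(B :: real^'n^'n) (C :: real^'n^'n). norm (B ** C) \<le> norm B * norm C * D"
    using mm.pos_bounded by blast
  have C0: "C \<ge> 0" using C[of 0] norm_ge_zero[of "A 0"] by linarith
  note obtained = that
  show ?thesis
  proof (rule lipschitz_ode_global_solution[where F = "\<lambda>t Z. - (Z ** A t)" and a = 0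
        and L = "C * D" and B = 0 and \<eta> = "mat 1"])
    show "continuous_on ({0..} \<times> UNIV) (\<lambda>(t, Z :: real^'n^'n). - (Z ** A t))"
      unfolding case_prod_beta
      by (intro continuous_intros mm.continuous_on continuous_on_compose2[OF A]) auto
    show "norm (- (Y ** A t) - - (Z ** A t)) \<le> C * D * norm (Y - Z)" if "t \<ge> 0"
      for t and Y Z :: "real^'n^'n"
    proof -
      have "norm (- (Y ** A t) - - (Z ** A t)) = norm ((Y - Z) ** A t)"
        by (simp add: mm.diff_left norm_minus_commute)
      also have "\<dots> \<le> norm (Y - Z) * C * D"
        using D C[OF that] by (intro order_trans[OF D(2)] mult_right_mono mult_left_mono) auto
      finally show ?thesis by (simp add: ac_simps)
    qed
    show "thesis" if "Z 0 = mat 1"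
      and "\<And>t. t \<ge> 0 \<Longrightarrow> (Z has_vector_derivative - (Z t ** A t)) (at t within {0..})" for Z
      using that by (rule obtained)
  qed (use C0 D(1) in \<open>auto simp: mm.zero_left\<close>)
qed

text \<open>Since \<open>Z' = - Z A\<close> and \<open>\<partial>\<^sub>t \<Phi> t s = A \<Phi> t s\<close>, the product \<open>Z t ** \<Phi> t s\<close> does not depend on
  \<open>t\<close>, hence equals its value \<open>Z s\<close> at \<open>t = s\<close>. The case \<open>s = 0\<close> says that \<open>Z t\<close> inverts
  \<open>\<Phi> t 0\<close>, and solving for \<open>\<Phi> t s\<close> gives the factorization.\<close>

lemma transition_matrix_factorization:
  fixes A :: "real \<Rightarrow> real^'n^'n"
  assumes A: "continuous_on {0..} A" and C: "\<And>t. t \<ge> 0 \<Longrightarrow> norm (A t) \<le> C"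
    and \<Phi>: "transition_matrix A \<Phi>"
  obtains Z where "\<And>t s. t \<ge> 0 \<Longrightarrow> s \<ge> 0 \<Longrightarrow> \<Phi> t 0 ** Z s = \<Phi> t s"
    and "\<And>t. t \<ge> 0 \<Longrightarrow> (Z has_vector_derivative - (Z t ** A t)) (at t within {0..})"
proof -
  interpret mm: bounded_bilinear "\<lambda>(B :: real^'n^'n) (C :: real^'n^'n). B ** C"
    by (rule bounded_bilinear_matrix_matrix_mult)
  obtain Z where Z0: "Z 0 = mat 1"
    and Z: "\<And>t. t \<ge> 0 \<Longrightarrow> (Z has_vector_derivative - (Z t ** A t)) (at t within {0..})"
    using adjoint_solution_exists[OF A C] by blast
  have const: "Z t ** \<Phi> t s = Z s" if "t \<ge> 0" "s \<ge> 0" for t s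
  proof -
    have "((\<lambda>\<tau>. Z \<tau> ** \<Phi> \<tau> s) has_vector_derivative 0) (at \<tau> within {0..})" if "\<tau> \<in> {0..}" for \<tau>
    proof -
      have "((\<lambda>\<tau>. \<Phi> \<tau> s) has_vector_derivative A \<tau> ** \<Phi> \<tau> s) (at \<tau> within {0..})"
        using \<Phi> \<open>s \<ge> 0\<close> that by (auto simp: transition_matrix_def)
      from mm.has_vector_derivative[OF Z this] that show ?thesis
        by (simp add: mm.minus_left matrix_mul_assoc)
    qed
    then obtain c where c: "\<And>\<tau>. \<tau> \<in> {0..} \<Longrightarrow> Z \<tau> ** \<Phi> \<tau> s = c"
      using has_vector_derivative_zero_constant[of "{0::real..}"] by auto
    have "\<Phi> s s = mat 1" using \<Phi> that by (simp add: transition_matrix_def)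
    with c[of t] c[of s] that show ?thesis by simp
  qed
  have inv: "\<Phi> t 0 ** Z t = mat 1" if "t \<ge> 0" for t
    using const[OF that, of 0] Z0 matrix_left_right_inverse by auto
  have "\<Phi> t 0 ** Z s = \<Phi> t s" if "t \<ge> 0" "s \<ge> 0" for t s
    using const[OF that] inv[OF that(1)] by (metis matrix_mul_assoc matrix_mul_lid)
  then show ?thesis using Z by (rule that)
qed

text \<open>The factorization \<open>\<Phi> t s = \<Phi> t 0 ** Z s\<close> reduces the formula to the fundamental theorem of
  calculus for \<open>Z \<tau> *v d \<tau>\<close>, whose derivative is \<open>Z \<tau> *v g \<tau>\<close>. Integrability of
  the forcing term comes with it, since derivatives are Henstock-Kurzweil integrable.\<close>

lemma variation_of_constants:
  fixes A :: "real \<Rightarrow> real^'n^'n"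
  assumes A: "continuous_on {0..} A" and C: "\<And>t. t \<ge> 0 \<Longrightarrow> norm (A t) \<le> C"
    and \<Phi>: "transition_matrix A \<Phi>"
    and st: "0 \<le> s" "s \<le> t"
    and d: "\<And>\<tau>. \<tau> \<ge> s \<Longrightarrow> (d has_vector_derivative A \<tau> *v d \<tau> + g \<tau>) (at \<tau> within {s..})"
  shows "((\<lambda>\<tau>. \<Phi> t \<tau> *v g \<tau>) has_integral d t - \<Phi> t s *v d s) {s..t}"
proof -
  interpret mv: bounded_bilinear "\<lambda>(B :: real^'n^'n) v. B *v v"
    by (rule bounded_bilinear_matrix_vector_mult)
  obtain Z where fac: "\<And>t s. t \<ge> 0 \<Longrightarrow> s \<ge> 0 \<Longrightarrow> \<Phi> t 0 ** Z s = \<Phi> t s"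
    and Z: "\<And>t. t \<ge> 0 \<Longrightarrow> (Z has_vector_derivative - (Z t ** A t)) (at t within {0..})"
    using transition_matrix_factorization[OF A C \<Phi>] by blast
  have "((\<lambda>\<tau>. Z \<tau> *v g \<tau>) has_integral Z t *v d t - Z s *v d s) {s..t}"
  proof (rule fundamental_theorem_of_calculus)
    fix \<tau> assume \<tau>: "\<tau> \<in> {s..t}"
    have "(Z has_vector_derivative - (Z \<tau> ** A \<tau>)) (at \<tau> within {s..t})"
      using \<tau> st by (intro has_vector_derivative_within_subset[OF Z]) auto
    moreover have "(d has_vector_derivative A \<tau> *v d \<tau> + g \<tau>) (at \<tau> within {s..t})"
      using \<tau> by (intro has_vector_derivative_within_subset[OF d]) auto
    ultimately have "((\<lambda>\<tau>. Z \<tau> *v d \<tau>) has_vector_derivative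
        Z \<tau> *v (A \<tau> *v d \<tau> + g \<tau>) + - (Z \<tau> ** A \<tau>) *v d \<tau>) (at \<tau> within {s..t})"
      by (rule mv.has_vector_derivative)
    then show "((\<lambda>\<tau>. Z \<tau> *v d \<tau>) has_vector_derivative Z \<tau> *v g \<tau>) (at \<tau> within {s..t})"
      by (simp add: mv.add_right mv.minus_left matrix_vector_mul_assoc)
  qed (use st in auto)
  then have "((\<lambda>\<tau>. \<Phi> t 0 *v (Z \<tau> *v g \<tau>)) has_integral \<Phi> t 0 *v (Z t *v d t - Z s *v d s)) {s..t}"
    by (rule has_integral_linear[OF _ mv.bounded_linear_right, unfolded o_def])
  also have "\<Phi> t 0 *v (Z t *v d t - Z s *v d s) = d t - \<Phi> t s *v d s"
    using st fac[of t t] fac[of t s] \<Phi>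
    by (simp add: mv.diff_right matrix_vector_mul_assoc transition_matrix_def)
  finally have int: "((\<lambda>\<tau>. \<Phi> t 0 *v (Z \<tau> *v g \<tau>)) has_integral d t - \<Phi> t s *v d s) {s..t}" .
  have "\<Phi> t 0 *v (Z \<tau> *v g \<tau>) = \<Phi> t \<tau> *v g \<tau>" if "\<tau> \<in> {s..t}" for \<tau>
    using st that fac[of t \<tau>] by (simp add: matrix_vector_mul_assoc)
  from has_integral_eq[OF this int] show ?thesis .
qed

section \<open>Exponential contraction between solutions\<close>

text \<open>The right-hand side of the integral inequality, damped by \<open>exp (- c (t - s))\<close>, has a derivative
  of the sign of \<open>\<phi> t - (a + c \<integral> \<phi>)\<close>, so it never exceeds its initial value \<open>a\<close>.\<close>

lemma gronwall:
  fixes \<phi> :: "real \<Rightarrow> real"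
  assumes \<phi>: "continuous_on {s..} \<phi>" and c: "c \<ge> 0"
    and le: "\<And>t. t \<ge> s \<Longrightarrow> \<phi> t \<le> a + c * integral {s..t} \<phi>"
    and t: "t \<ge> s"
  shows "\<phi> t \<le> a * exp (c * (t - s))"
proof -
  define H where "H r = (a + c * integral {s..r} \<phi>) * exp (- c * (r - s))" for r
  have D: "(H has_real_derivative c * (\<phi> r - (a + c * integral {s..r} \<phi>)) * exp (- c * (r - s)))
      (at r within {s..t})" if "r \<in> {s..t}" for r
  proof -
    have "((\<lambda>r. integral {s..r} \<phi>) has_real_derivative \<phi> r) (at r within {s..t})"
      using that by (intro integral_has_real_derivative continuous_on_subset[OF \<phi>]) auto
    then show ?thesis
      unfolding H_def by (auto intro!: derivative_eq_intros simp: algebra_simps)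
  qed
  have "H t \<le> H s"
  proof (rule DERIV_nonpos_imp_decreasing_open[OF t])
    show "continuous_on {s..t} H"
      using D by (rule DERIV_continuous_on)
    fix r assume r: "s < r" "r < t"
    then have "(H has_real_derivative c * (\<phi> r - (a + c * integral {s..r} \<phi>)) * exp (- c * (r - s)))
        (at r)"
      using D[of r] by (simp add: at_within_Icc_at)
    moreover have "c * (\<phi> r - (a + c * integral {s..r} \<phi>)) * exp (- c * (r - s)) \<le> 0"
      using le[of r] r c by (intro mult_nonpos_nonneg mult_nonneg_nonpos) auto
    ultimately show "\<exists>y. (H has_real_derivative y) (at r) \<and> y \<le> 0" by blast
  qed
  then have "(a + c * integral {s..t} \<phi>) * exp (- c * (t - s)) * exp (c * (t - s))
      \<le> a * exp (c * (t - s))"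
    by (intro mult_right_mono) (auto simp: H_def)
  then have "a + c * integral {s..t} \<phi> \<le> a * exp (c * (t - s))"
    by (simp add: mult.assoc flip: exp_add)
  with le[OF t] show ?thesis by linarith
qed

text \<open>The weight \<open>exp (\<alpha> (\<tau> - s))\<close> in \<open>\<phi>\<close> cancels the decay of \<open>\<Phi>\<close> under the integral, which puts the
  variation of constants formula into the form that Gronwall's inequality needs. The coefficient
  \<open>K \<gamma>\<close> of the integral is then the loss in the exponential rate.\<close>

lemma solutions_contract:
  fixes N :: "real^'n \<Rightarrow> real" and A :: "real \<Rightarrow> real^'n^'n"
  assumes N: "is_norm N" and NP: "compatible_norms N P"
    and A: "continuous_on {0..} A" and C: "\<And>t. t \<ge> 0 \<Longrightarrow> norm (A t) \<le> C"
    and \<Phi>: "transition_matrix A \<Phi>"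
    and dich: "\<And>t s. 0 \<le> s \<Longrightarrow> s \<le> t \<Longrightarrow> P (\<Phi> t s) \<le> K * exp (- \<alpha> * (t - s))"
    and K: "K \<ge> 0" and \<gamma>: "\<gamma> \<ge> 0"
    and lip: "\<And>t y z. t \<ge> 0 \<Longrightarrow> N (f t y - f t z) \<le> \<gamma> * N (y - z)"
    and u: "solves_ivp A f s \<eta> u" and v: "solves_ivp A f s \<zeta> v"
    and st: "0 \<le> s" "s \<le> t"
  shows "N (u t - v t) \<le> K * exp (- (\<alpha> - K * \<gamma>) * (t - s)) * N (\<eta> - \<zeta>)"
proof -
  define d where "d \<tau> = u \<tau> - v \<tau>" for \<tau>
  define g where "g \<tau> = f \<tau> (u \<tau>) - f \<tau> (v \<tau>)" for \<tau>
  have d: "(d has_vector_derivative A \<tau> *v d \<tau> + g \<tau>) (at \<tau> within {s..})" if "\<tau> \<ge> s" for \<tau>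
  proof -
    have "(d has_vector_derivative (A \<tau> *v u \<tau> + f \<tau> (u \<tau>)) - (A \<tau> *v v \<tau> + f \<tau> (v \<tau>)))
        (at \<tau> within {s..})"
      unfolding d_def using u v that
      by (intro has_vector_derivative_diff) (auto simp: solves_ivp_def)
    then show ?thesis
      by (simp add: d_def g_def algebra_simps)
  qed
  have ds: "d s = \<eta> - \<zeta>"
    using u v by (simp add: d_def solves_ivp_def)
  have mv: "N (\<Phi> t \<tau> *v x) \<le> K * exp (- \<alpha> * (t - \<tau>)) * N x" if "0 \<le> \<tau>" "\<tau> \<le> t" for t \<tau> x
    using NP dich[OF that] is_norm_nonneg[OF N, of x]
    by (meson compatible_norms_def mult_right_mono order_trans)
  define \<phi> where "\<phi> \<tau> = exp (\<alpha> * (\<tau> - s)) * N (d \<tau>)" for \<tau>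
  have "continuous_on {s..} d"
    using d by (auto simp: continuous_on_eq_continuous_within intro: has_vector_derivative_continuous)
  then have \<phi>: "continuous_on {s..} \<phi>"
    unfolding \<phi>_def
    by (intro continuous_intros continuous_on_compose2[OF is_norm_continuous_on[OF N, of UNIV]]) auto
  have "\<phi> t \<le> K * N (d s) + K * \<gamma> * integral {s..t} \<phi>" if t: "t \<ge> s" for t
  proof -
    have "N (d t - \<Phi> t s *v d s) \<le> K * \<gamma> * exp (- \<alpha> * (t - s)) * integral {s..t} \<phi>"
    proof (rule is_norm_has_integral_le[OF N variation_of_constants[OF A C \<Phi> st(1) t d]])
      show "((\<lambda>\<tau>. K * \<gamma> * exp (- \<alpha> * (t - s)) * \<phi> \<tau>) has_integral
          K * \<gamma> * exp (- \<alpha> * (t - s)) * integral {s..t} \<phi>) {s..t}"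
        by (intro has_integral_mult_right integrable_integral integrable_continuous_real
            continuous_on_subset[OF \<phi>]) auto
      fix \<tau> assume \<tau>: "\<tau> \<in> {s..t}"
      have "N (\<Phi> t \<tau> *v g \<tau>) \<le> K * exp (- \<alpha> * (t - \<tau>)) * N (g \<tau>)"
        using \<tau> st by (intro mv) auto
      also have "\<dots> \<le> K * exp (- \<alpha> * (t - \<tau>)) * (\<gamma> * N (d \<tau>))"
        using \<tau> st K lip[of \<tau> "u \<tau>" "v \<tau>"] by (intro mult_left_mono) (auto simp: g_def d_def)
      also have "exp (- \<alpha> * (t - \<tau>)) = exp (- \<alpha> * (t - s)) * exp (\<alpha> * (\<tau> - s))"
        by (simp add: algebra_simps flip: exp_add)
      finally show "N (\<Phi> t \<tau> *v g \<tau>) \<le> K * \<gamma> * exp (- \<alpha> * (t - s)) * \<phi> \<tau>"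
        by (simp add: \<phi>_def ac_simps)
    qed auto
    then have "N (d t) \<le> exp (- \<alpha> * (t - s)) * (K * N (d s) + K * \<gamma> * integral {s..t} \<phi>)"
      using mv[OF st(1) t, of "d s"] is_norm_triangle_diff[OF N, of "d t" "\<Phi> t s *v d s"]
      by (simp add: algebra_simps)
    then have "exp (\<alpha> * (t - s)) * N (d t)
        \<le> exp (\<alpha> * (t - s)) * (exp (- \<alpha> * (t - s)) * (K * N (d s) + K * \<gamma> * integral {s..t} \<phi>))"
      by (intro mult_left_mono) auto
    then show ?thesis
      by (simp add: \<phi>_def flip: exp_add mult.assoc)
  qed
  then have "\<phi> t \<le> K * N (d s) * exp (K * \<gamma> * (t - s))"
    using K \<gamma> st(2) by (intro gronwall[OF \<phi>]) auto
  then have "exp (- \<alpha> * (t - s)) * \<phi> t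
      \<le> exp (- \<alpha> * (t - s)) * (K * N (d s) * exp (K * \<gamma> * (t - s)))"
    by (intro mult_left_mono) auto
  also have "\<dots> = K * exp (- (\<alpha> - K * \<gamma>) * (t - s)) * N (\<eta> - \<zeta>)"
    by (simp add: ds algebra_simps flip: exp_add)
  also have "exp (- \<alpha> * (t - s)) * \<phi> t = N (u t - v t)"
    by (simp add: \<phi>_def d_def flip: exp_add mult.assoc)
  finally show ?thesis .
qed

section \<open>Global uniform asymptotic stability\<close>

text \<open>The Lipschitz and boundedness hypotheses on \<open>f\<close> are in terms of \<open>N\<close>; equivalence of norms carries
  them to the Euclidean norm, in which the existence theorem is applied.\<close>

lemma perturbed_linear_solution_exists:
  fixes N :: "real^'n \<Rightarrow> real" and A :: "real \<Rightarrow> real^'n^'n"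
  assumes N: "is_norm N"
    and A: "continuous_on {0..} A" and C: "\<And>t. t \<ge> 0 \<Longrightarrow> norm (A t) \<le> C"
    and f: "continuous_on ({0..} \<times> UNIV) (\<lambda>(t, y). f t y)"
    and \<gamma>: "\<gamma> \<ge> 0"
    and lip: "\<And>t y z. t \<ge> 0 \<Longrightarrow> N (f t y - f t z) \<le> \<gamma> * N (y - z)"
    and bdd: "\<And>t y. t \<ge> 0 \<Longrightarrow> N (f t y) \<le> \<mu>"
    and t0: "t0 \<ge> 0"
  shows "\<exists>u. solves_ivp A f t0 \<eta> u"
proof -
  interpret mv: bounded_bilinear "\<lambda>(B :: real^'n^'n) v. B *v v"
    by (rule bounded_bilinear_matrix_vector_mult)
  obtain D where D: "D > 0" "\<And>(B :: real^'n^'n) v. norm (B *v v) \<le> norm B * norm v * D"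
    using mv.pos_bounded by blast
  obtain a where a: "a > 0" "\<And>x. N x \<le> a * norm x"
    using is_norm_bounded_by_norm[OF N] by blast
  obtain b where b: "b > 0" "\<And>x. norm x \<le> b * N x"
    using is_norm_bounds_norm[OF N] by blast
  have C0: "C \<ge> 0" using C[of 0] norm_ge_zero[of "A 0"] by linarith
  show ?thesis
  proof (rule lipschitz_ode_global_solution[where F = "\<lambda>t y. A t *v y + f t y" and a = t0
        and L = "C * D + b * \<gamma> * a" and B = "b * \<mu>" and \<eta> = \<eta>])
    have "continuous_on ({t0..} \<times> UNIV) (\<lambda>z. A (fst z) *v snd z)"
      using t0 by (intro mv.continuous_on continuous_on_compose2[OF A] continuous_intros) auto
    moreover have "continuous_on ({t0..} \<times> UNIV) (\<lambda>(t, y). f t y)"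
      using t0 by (intro continuous_on_subset[OF f]) auto
    ultimately show "continuous_on ({t0..} \<times> UNIV) (\<lambda>(t, y). A t *v y + f t y)"
      unfolding case_prod_beta by (intro continuous_on_add)
    show "\<exists>u. solves_ivp A f t0 \<eta> u" if "u t0 = \<eta>"
      and "\<And>t. t \<ge> t0 \<Longrightarrow> (u has_vector_derivative A t *v u t + f t (u t)) (at t within {t0..})" for u
      using that by (intro exI[of _ u]) (simp add: solves_ivp_def)
    fix t assume t: "t \<ge> t0"
    then have t': "t \<ge> 0" using t0 by simp
    show "norm (A t *v 0 + f t 0) \<le> b * \<mu>"
      using b(1) b(2)[of "f t 0"] bdd[OF t', of 0] by (simp add: order_trans mult_left_mono)
    fix x y
    have "norm (A t *v x - A t *v y) \<le> norm (A t) * norm (x - y) * D"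
      unfolding mv.diff_right[symmetric] by (rule D(2))
    also have "\<dots> \<le> C * norm (x - y) * D"
      using C[OF t'] D(1) by (intro mult_right_mono) auto
    finally have 1: "norm (A t *v x - A t *v y) \<le> C * D * norm (x - y)"
      by (simp add: ac_simps)
    have "norm (f t x - f t y) \<le> b * N (f t x - f t y)"
      by (rule b(2))
    also have "\<dots> \<le> b * (\<gamma> * (a * norm (x - y)))"
      using b(1) \<gamma> by (intro mult_left_mono order_trans[OF lip[OF t']] a) auto
    finally have 2: "norm (f t x - f t y) \<le> b * \<gamma> * a * norm (x - y)"
      by (simp add: ac_simps)
    have "norm (A t *v x + f t x - (A t *v y + f t y))
        \<le> norm (A t *v x - A t *v y) + norm (f t x - f t y)"
      unfolding add_diff_add by (rule norm_triangle_ineq)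
    with 1 2 show "norm (A t *v x + f t x - (A t *v y + f t y))
        \<le> (C * D + b * \<gamma> * a) * norm (x - y)"
      by (simp add: distrib_right)
  qed (use C0 D(1) a(1) b(1) \<gamma> in auto)
qed

lemma exp_decay_uniformly_stable:
  assumes K: "K > 0" and \<beta>: "\<beta> \<ge> 0"
    and N: "is_norm N"
    and decay: "\<And>t t0 \<eta>. 0 \<le> t0 \<Longrightarrow> t0 \<le> t \<Longrightarrow>
      N (y t t0 \<eta> - yb) \<le> K * exp (- \<beta> * (t - t0)) * N (\<eta> - yb)"
  shows "uniformly_stable N y yb"
  unfolding uniformly_stable_def
proof (intro allI impI)
  fix \<epsilon> :: real assume \<epsilon>: "\<epsilon> > 0"
  show "\<exists>\<delta>>0. \<forall>t0\<ge>0. \<forall>\<eta>. N (\<eta> - yb) < \<delta> \<longrightarrow> (\<forall>t\<ge>t0. N (y t t0 \<eta> - yb) < \<epsilon>)"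
  proof (intro exI[of _ "\<epsilon> / K"] conjI allI impI)
    fix t0 t :: real and \<eta> assume t: "0 \<le> t0" "t0 \<le> t" and \<eta>: "N (\<eta> - yb) < \<epsilon> / K"
    have "N (y t t0 \<eta> - yb) \<le> K * exp (- \<beta> * (t - t0)) * N (\<eta> - yb)"
      by (rule decay[OF t])
    also have "\<dots> \<le> K * 1 * N (\<eta> - yb)"
      using K \<beta> t is_norm_nonneg[OF N] by (intro mult_right_mono mult_left_mono) auto
    also have "\<dots> < \<epsilon>"
      using \<eta> K by (simp add: field_simps)
    finally show "N (y t t0 \<eta> - yb) < \<epsilon>" .
  qed (use \<epsilon> K in auto)
qed

lemma exp_decay_globally_uniformly_attractive:
  assumes K: "K > 0" and \<beta>: "\<beta> > 0"
    and decay: "\<And>t t0 \<eta>. 0 \<le> t0 \<Longrightarrow> t0 \<le> t \<Longrightarrow>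
      N (y t t0 \<eta> - yb) \<le> K * exp (- \<beta> * (t - t0)) * N (\<eta> - yb)"
  shows "globally_uniformly_attractive N y yb"
  unfolding globally_uniformly_attractive_def
proof (intro allI impI)
  fix \<epsilon> c :: real assume \<epsilon>: "\<epsilon> > 0" and c: "c > 0"
  \<comment> \<open>From \<open>1 + x \<le> exp x\<close>: the decay factor is below \<open>1 / (\<beta> T) = \<epsilon> / (K c)\<close> after time \<open>T\<close>.\<close>
  define T where "T = K * c / (\<beta> * \<epsilon>)"
  show "\<exists>T>0. \<forall>t0\<ge>0. \<forall>t>t0 + T. \<forall>\<eta>. N (\<eta> - yb) < c \<longrightarrow> N (y t t0 \<eta> - yb) < \<epsilon>"
  proof (intro exI[of _ T] conjI allI impI)
    show "T > 0" using K \<beta> \<epsilon> c by (simp add: T_def)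
    fix t0 t :: real and \<eta> assume t: "0 \<le> t0" "t0 + T < t" and \<eta>: "N (\<eta> - yb) < c"
    have "K * c / \<epsilon> = \<beta> * T" using \<beta> by (simp add: T_def)
    also have "\<dots> < 1 + \<beta> * (t - t0)"
      using t(2) \<beta> by (smt (verit) mult_strict_left_mono)
    also have "\<dots> \<le> exp (\<beta> * (t - t0))"
      by (rule exp_ge_add_one_self)
    finally have "exp (- \<beta> * (t - t0)) * (K * c) < exp (- \<beta> * (t - t0)) * (exp (\<beta> * (t - t0)) * \<epsilon>)"
      using \<epsilon> by (simp add: pos_divide_less_eq)
    also have "\<dots> = \<epsilon>"
      by (simp flip: exp_add mult.assoc)
    finally have e: "K * exp (- \<beta> * (t - t0)) * c < \<epsilon>"
      by (simp add: ac_simps)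
    have "N (y t t0 \<eta> - yb) \<le> K * exp (- \<beta> * (t - t0)) * N (\<eta> - yb)"
      using t \<open>T > 0\<close> by (intro decay) auto
    also have "\<dots> \<le> K * exp (- \<beta> * (t - t0)) * c"
      using \<eta> K by (intro mult_left_mono) auto
    finally show "N (y t t0 \<eta> - yb) < \<epsilon>" using e by linarith
  qed
qed

theorem theorem2:
  fixes N :: "real^'n \<Rightarrow> real"
    and P :: "real^'n^'n \<Rightarrow> real"
    and A :: "real \<Rightarrow> real^'n^'n"
    and \<Phi> :: "real \<Rightarrow> real \<Rightarrow> real^'n^'n"
    and f :: "real \<Rightarrow> real^'n \<Rightarrow> real^'n"
    and M K \<alpha> \<gamma> \<mu> :: real
    and yb :: "real^'n"
  assumes "is_norm N" and "is_norm P" and "compatible_norms N P"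
    and "continuous_on {0..} A"
    and "bdd_above ((\<lambda>t. P (A t)) ` {0..})"
    and "(SUP t\<in>{0..}. P (A t)) = M" and "M > 0"
    and "K \<ge> 1" and "\<alpha> > 0"
    and "transition_matrix A \<Phi>"
    and "\<And>t s. 0 \<le> s \<Longrightarrow> s \<le> t \<Longrightarrow> P (\<Phi> t s) \<le> K * exp (- \<alpha> * (t - s))"
    and "continuous_on ({0..} \<times> UNIV) (\<lambda>(t, y). f t y)"
    and "\<gamma> \<ge> 0" and "\<mu> \<ge> 0"
    and "\<And>t y z. t \<ge> 0 \<Longrightarrow> N (f t y - f t z) \<le> \<gamma> * N (y - z)"
    and "\<And>t y. t \<ge> 0 \<Longrightarrow> N (f t y) \<le> \<mu>"
    and "K * \<gamma> / \<alpha> < 1"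
    and "equilibrium A f yb"
    and "\<And>z. equilibrium A f z \<Longrightarrow> z = yb"
    and "yb \<noteq> 0"
  shows "globally_uniformly_asymptotically_stable N A f yb"
proof -
  note N = assms(1) and NP = assms(3) and A = assms(4) and \<Phi> = assms(10)
    and dich = assms(11) and lip = assms(15) and bdd = assms(16)
  obtain b where b: "b > 0" "\<And>B. norm B \<le> b * P B"
    using is_norm_bounds_norm[OF assms(2)] by blast
  have C: "norm (A t) \<le> b * M" if "t \<ge> 0" for t
  proof -
    have "P (A t) \<le> M"
      unfolding assms(6)[symmetric] using that by (intro cSUP_upper assms(5)) auto
    then show ?thesis using b(1) b(2)[of "A t"] by (smt (verit) mult_left_mono)
  qed
  \<comment> \<open>The rate left after the perturbation; its positivity is the smallness condition on \<open>\<gamma>\<close>.\<close>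
  define \<beta> where "\<beta> = \<alpha> - K * \<gamma>"
  have \<beta>: "\<beta> > 0" using assms(9,17) by (simp add: \<beta>_def field_simps)
  have K: "K > 0" using assms(8) by simp
  have contract: "N (u t - v t) \<le> K * exp (- \<beta> * (t - t0)) * N (\<eta> - \<zeta>)"
    if "solves_ivp A f t0 \<eta> u" "solves_ivp A f t0 \<zeta> v" "0 \<le> t0" "t0 \<le> t" for u v t0 t \<eta> \<zeta>
    unfolding \<beta>_def using K that
    by (intro solutions_contract[OF N NP A C \<Phi> dich _ assms(13) lip]) auto
  define y where "y t t0 \<eta> = (SOME u. solves_ivp A f t0 \<eta> u) t" for t t0 \<eta>
  have y: "solves_ivp A f t0 \<eta> (\<lambda>t. y t t0 \<eta>)" if "t0 \<ge> 0" for t0 \<eta>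
    unfolding y_def
    using someI_ex[OF perturbed_linear_solution_exists[OF N A C assms(12,13) lip bdd that]] by simp
  have "solution_map A f y"
    unfolding solution_map_def
  proof (intro allI impI conjI)
    fix t0 :: real and \<eta> assume t0: "0 \<le> t0"
    show "solves_ivp A f t0 \<eta> (\<lambda>t. y t t0 \<eta>)" by (rule y[OF t0])
    fix u t assume u: "solves_ivp A f t0 \<eta> u" and t: "t0 \<le> t"
    have "N (u t - y t t0 \<eta>) \<le> 0"
      using contract[OF u y[OF t0, of \<eta>] t0 t] by (simp add: is_norm_zero[OF N])
    then show "u t = y t t0 \<eta>"
      using N is_norm_nonneg[OF N, of "u t - y t t0 \<eta>"] by (auto simp: is_norm_def)
  qed
  have yb: "solves_ivp A f t0 yb (\<lambda>t. yb)" if "t0 \<ge> 0" for t0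
    using assms(18) that by (auto simp: solves_ivp_def equilibrium_def)
  have decay: "N (y t t0 \<eta> - yb) \<le> K * exp (- \<beta> * (t - t0)) * N (\<eta> - yb)"
    if "0 \<le> t0" "t0 \<le> t" for t t0 \<eta>
    using contract[OF y[OF that(1)] yb[OF that(1)] that] by simp
  have "uniformly_stable N y yb"
    using exp_decay_uniformly_stable[OF K less_imp_le[OF \<beta>] N decay] .
  moreover have "globally_uniformly_attractive N y yb"
    using exp_decay_globally_uniformly_attractive[OF K \<beta> decay] .
  ultimately show ?thesis
    unfolding globally_uniformly_asymptotically_stable_def
    using \<open>solution_map A f y\<close> by blast
qed

end
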